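(* Let $V$ be a separable metrizable locally convex vector space over $\mathbb{R}$, let $T:V^{\mathbb{N}}\to V^{\mathbb{N}}$ be the Cesaro operator, and let $A\subseteq V$ be a vector space (a linear subspace of $V$). Let $$\Theta_{A,V}=\{\vartheta\in A^{\mathbb{N}} : \text{for every } k=1,2,\ldots \text{ the sequence } [T^k(\vartheta)]_n,\ n=1,2,\ldots, \text{ is dense in } \operatorname{conv}(A)\}.$$ Then $\Theta_{A,V}$ contains, with the exception of $0$, a vector subspace dense in $A^{\mathbb{N}}$; that is, there is a linear subspace $E\subseteq A^{\mathbb{N}}$, dense in $A^{\mathbb{N}}$ for the product topology, with $E\setminus\{0\}\subseteq\Theta_{A,V}$.
   Context: $\mathbb{N}=\{1,2,\ldots\}$. The topology of $V$ is given by a countable separating family of seminorms. The Cesaro operator $T:V^{\mathbb{N}}\to V^{\mathbb{N}}$ is defined by $[T(a)]_n=\frac{a_1+\cdots+a_n}{n}$ for $a=(a_n)\in V^{\mathbb{N}}$, where $[b]_n$ denotes the $n$-th term of a sequence $b$; $T^1=T$ and $T^k=T\circ T^{k-1}$ for $k\ge 2$. $\operatorname{conv}(A)$ is the convex hull of $A$ (here equal to $A$). *)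

theory Defs
  imports "HOL-Analysis.Analysis" "HOL-Library.Function_Algebras"
begin

text \<open>
  Pointwise scalar multiplication (the pointwise additive structure is that of
  \<open>Function_Algebras\<close>), so that \<open>subspace\<close> applies to sets of sequences.
\<close>

instantiation "fun" :: (type, real_vector) real_vector
begin

definition scaleR_fun :: "real \<Rightarrow> ('a \<Rightarrow> 'b) \<Rightarrow> 'a \<Rightarrow> 'b" where
  "scaleR_fun c f = (\<lambda>x. c *\<^sub>R f x)"

instance
  by standard
    (simp_all add: scaleR_fun_def fun_eq_iff scaleR_add_right scaleR_add_left)

end

definition seminorm :: "('a::real_vector \<Rightarrow> real) \<Rightarrow> bool" where
  "seminorm p \<longleftrightarrow>
     (\<forall>x y. p (x + y) \<le> p x + p y) \<and> (\<forall>c x. p (c *\<^sub>R x) = \<bar>c\<bar> * p x)"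

definition separating :: "('a::real_vector \<Rightarrow> real) set \<Rightarrow> bool" where
  "separating P \<longleftrightarrow> (\<forall>x. x \<noteq> 0 \<longrightarrow> (\<exists>p\<in>P. p x \<noteq> 0))"

definition topology_given_by ::
    "('a::{real_vector,topological_space} \<Rightarrow> real) set \<Rightarrow> bool" where
  "topology_given_by P \<longleftrightarrow>
     (open :: 'a set \<Rightarrow> bool) =
       generate_topology {{y. p (y - x) < e} | p x e. p \<in> P \<and> e > 0}"

text \<open>
  Sequences are indexed from \<open>0\<close>: the value at \<open>n\<close> is the term of index \<open>n + 1\<close>
  in the convention \<open>\<nat> = {1, 2, \<dots>}\<close>.
\<close>

definition cesaro :: "(nat \<Rightarrow> 'a::real_vector) \<Rightarrow> nat \<Rightarrow> 'a" where
  "cesaro a = (\<lambda>n. (\<Sum>i\<le>n. a i) /\<^sub>R real (n + 1))"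

definition dense_in :: "'a::topological_space set \<Rightarrow> 'a set \<Rightarrow> bool" where
  "dense_in S B \<longleftrightarrow> S \<subseteq> B \<and> B \<subseteq> closure S"

definition seqs :: "'a set \<Rightarrow> (nat \<Rightarrow> 'a) set" where
  "seqs A = {a. \<forall>n. a n \<in> A}"

definition Theta :: "'a::{real_vector,topological_space} set \<Rightarrow> (nat \<Rightarrow> 'a) set" where
  "Theta A = {\<theta> \<in> seqs A. \<forall>k\<ge>1. dense_in (range ((cesaro ^^ k) \<theta>)) (convex hull A)}"

end

theory Submission
  imports Defs
begin

text \<open>
  On a very long block \<open>[N, M)\<close> on which a sequence is constantly \<open>v\<close>, all the iterated means
  of the sequence up to any given order are close to \<open>v\<close> at the end of the block. Take a countable
  dense subset of \<open>A\<close> and let the sequence \<open>u j\<close> start with the \<open>j\<close>-th finite list over it and then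
  be constant on rapidly growing blocks. Each block serves one index \<open>j\<close> and one point \<open>d\<close>: on it
  \<open>u j\<close> has the value \<open>d\<close> and all the other sequences vanish; each pair is served infinitely
  often. At the ends of the blocks serving \<open>j\<close>, the iterated means of a combination with
  coefficient \<open>c \<noteq> 0\<close> at \<open>u j\<close> are close to \<open>c d\<close>, and these points are dense in \<open>A\<close>. The
  span of the \<open>u j\<close> is dense because of the freely prescribed initial lists.
\<close>

subsection \<open>Iterated means\<close>

lemma cesaro_diff_const: "cesaro (\<lambda>i. x i - v) = (\<lambda>n. cesaro x n - v)"
  by (simp add: cesaro_def sum_subtractf sum_constant_scaleR scaleR_diff_right
      del: of_nat_Suc of_nat_add)

lemma cesaro_pow_diff_const: "(cesaro ^^ k) (\<lambda>i. x i - v) = (\<lambda>n. (cesaro ^^ k) x n - v)"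
  by (induction k) (simp_all add: cesaro_diff_const)

lemma cesaro_mult:
  fixes f :: "nat \<Rightarrow> real"
  shows "cesaro (\<lambda>i. c * f i) = (\<lambda>n. c * cesaro f n)"
  by (simp add: cesaro_def sum_distrib_left[symmetric] mult.left_commute)

lemma cesaro_pow_mult:
  fixes f :: "nat \<Rightarrow> real"
  shows "(cesaro ^^ k) (\<lambda>i. c * f i) = (\<lambda>n. c * (cesaro ^^ k) f n)"
  by (induction k) (simp_all add: cesaro_mult)

lemma cesaro_mono:
  fixes f g :: "nat \<Rightarrow> real"
  assumes "\<And>i. i \<le> n \<Longrightarrow> f i \<le> g i"
  shows "cesaro f n \<le> cesaro g n"
  unfolding cesaro_def by (intro scaleR_left_mono sum_mono) (use assms in auto)

text \<open>Every iterated mean at \<open>n\<close> combines only the terms up to \<open>n\<close>,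
  with nonnegative weights. A comparison up to \<open>n\<close> is therefore enough, which allows
  estimates at the end of a block without knowing later blocks.\<close>

lemma cesaro_pow_mono:
  fixes f g :: "nat \<Rightarrow> real"
  assumes "\<And>i. i \<le> n \<Longrightarrow> f i \<le> g i"
  shows "(cesaro ^^ k) f n \<le> (cesaro ^^ k) g n"
  using assms
proof (induction k arbitrary: n)
  case (Suc k)
  show ?case
    using Suc by (auto intro!: cesaro_mono)
qed simp

lemma cesaro_pow_mem_subspace:
  assumes "subspace A" "x \<in> seqs A"
  shows "(cesaro ^^ k) x \<in> seqs A"
proof (induction k)
  case (Suc k)
  then show ?case
    using assms(1) by (auto simp: seqs_def cesaro_def intro!: subspace_scale subspace_sum)
qed (use assms in simp)

lemma cesaro_tendsto_zero:
  fixes f :: "nat \<Rightarrow> real"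
  assumes "f \<longlonglongrightarrow> 0"
  shows "cesaro f \<longlonglongrightarrow> 0"
proof (rule LIMSEQ_I)
  fix e :: real
  assume e: "0 < e"
  obtain N where N: "\<And>n. n \<ge> N \<Longrightarrow> \<bar>f n\<bar> < e / 2"
    using LIMSEQ_D[OF assms, of "e / 2"] e by auto
  define S where "S = (\<Sum>i<N. \<bar>f i\<bar>)"
  obtain M :: nat where M: "2 * S / e < real M"
    using reals_Archimedean2 by blast
  show "\<exists>no. \<forall>n\<ge>no. norm (cesaro f n - 0) < e"
  proof (intro exI allI impI)
    fix n
    assume n: "n \<ge> max N M"
    have "\<bar>\<Sum>i\<le>n. f i\<bar> \<le> (\<Sum>i\<le>n. \<bar>f i\<bar>)"
      by (rule sum_abs)
    \<comment> \<open>The terms before \<open>N\<close> are kept whole and contribute the fixed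
      amount \<open>S\<close>; all later ones are below \<open>e / 2\<close>. Choosing
      \<open>n\<close> at least \<open>M\<close> makes \<open>S\<close> smaller than the remaining
      half.\<close>
    also have "\<dots> \<le> (\<Sum>i\<le>n. (if i < N then \<bar>f i\<bar> else 0) + e / 2)"
      using N e by (intro sum_mono) (auto simp: less_imp_le)
    also have "\<dots> = S + real (n + 1) * (e / 2)"
    proof -
      have "{..n} \<inter> {i. i < N} = {..<N}"
        using n by auto
      then show ?thesis
        by (simp add: sum.distrib sum.If_cases S_def)
    qed
    also have "S < real (n + 1) * (e / 2)"
    proof -
      have "S < real M * (e / 2)"
        using M e by (simp add: field_simps)
      also have "\<dots> \<le> real (n + 1) * (e / 2)"
        using n e by (intro mult_right_mono) auto
      finally show ?thesis .
    qed
    finally have "\<bar>\<Sum>i\<le>n. f i\<bar> < real (n + 1) * e"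
      by (simp add: algebra_simps)
    moreover have "norm (cesaro f n - 0) = \<bar>\<Sum>i\<le>n. f i\<bar> / real (n + 1)"
      by (simp add: cesaro_def abs_mult divide_inverse_commute)
    ultimately show "norm (cesaro f n - 0) < e"
      by (simp add: pos_divide_less_eq algebra_simps)
  qed
qed

lemma cesaro_pow_tendsto_zero:
  fixes f :: "nat \<Rightarrow> real"
  assumes "f \<longlonglongrightarrow> 0"
  shows "(cesaro ^^ k) f \<longlonglongrightarrow> 0"
  by (induction k) (use assms cesaro_tendsto_zero in auto)

text \<open>This value is the total weight that the \<open>k\<close>-th mean at a given index puts
  on the terms before \<open>N\<close>. It measures how much of the past is still
  remembered.\<close>

lemma cesaro_pow_initial_tendsto_zero:
  "(cesaro ^^ k) (\<lambda>i. of_bool (i < N) :: real) \<longlonglongrightarrow> 0"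
proof (rule cesaro_pow_tendsto_zero)
  have "\<forall>\<^sub>F i in sequentially. of_bool (i < N) = (0::real)"
    using eventually_ge_at_top[of N] by eventually_elim auto
  then show "(\<lambda>i. of_bool (i < N) :: real) \<longlonglongrightarrow> 0"
    by (rule tendsto_eventually)
qed

subsection \<open>Seminorms and the topology they generate\<close>

lemma seminorm_triangle: "seminorm p \<Longrightarrow> p (x + y) \<le> p x + p y"
  and seminorm_scaleR: "seminorm p \<Longrightarrow> p (c *\<^sub>R x) = \<bar>c\<bar> * p x"
  by (auto simp: seminorm_def)

lemma seminorm_zero: "seminorm p \<Longrightarrow> p 0 = 0"
  using seminorm_scaleR[of p 0 0] by simp

lemma seminorm_minus: "seminorm p \<Longrightarrow> p (- x) = p x"
  using seminorm_scaleR[of p "-1" x] by simp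

lemma seminorm_minus_commute: "seminorm p \<Longrightarrow> p (x - y) = p (y - x)"
  using seminorm_minus[of p "x - y"] by simp

lemma seminorm_triangle_diff: "seminorm p \<Longrightarrow> p (x - z) \<le> p (x - y) + p (y - z)"
  using seminorm_triangle[of p "x - y" "y - z"] by simp

lemma seminorm_diff_le: "seminorm p \<Longrightarrow> p (x - y) \<le> p x + p y"
  using seminorm_triangle[of p x "- y"] seminorm_minus[of p y] by simp

lemma seminorm_nonneg: "seminorm p \<Longrightarrow> 0 \<le> p x"
  using seminorm_diff_le[of p x x] seminorm_zero[of p] by simp

lemma seminorm_sum:
  assumes "seminorm p"
  shows "p (\<Sum>i\<in>F. f i) \<le> (\<Sum>i\<in>F. p (f i))"
proof (induction F rule: infinite_finite_induct)
  case (insert i F)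
  then show ?case
    using seminorm_triangle[OF assms, of "f i" "sum f F"] by simp
qed (simp_all add: seminorm_zero[OF assms])

text \<open>Each mean is a convex combination, so a seminorm passes inside one mean at a time;
  monotonicity of the outer mean carries the induction.\<close>

lemma seminorm_cesaro_pow_le:
  assumes "seminorm p"
  shows "p ((cesaro ^^ k) x n) \<le> (cesaro ^^ k) (\<lambda>i. p (x i)) n"
proof (induction k arbitrary: n)
  case (Suc k)
  have "p (cesaro y n) \<le> cesaro (\<lambda>i. p (y i)) n" for y
    using seminorm_sum[OF assms, of y "{..n}"]
    by (simp add: cesaro_def seminorm_scaleR[OF assms] mult_left_mono del: of_nat_add of_nat_Suc)
  then have "p (cesaro ((cesaro ^^ k) x) n) \<le> cesaro (\<lambda>i. p ((cesaro ^^ k) x i)) n" .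
  also have "\<dots> \<le> cesaro ((cesaro ^^ k) (\<lambda>i. p (x i))) n"
    using Suc by (intro cesaro_mono)
  finally show ?case by simp
qed simp

text \<open>Taking means commutes with subtracting \<open>v\<close>. The differences
  \<open>x i - v\<close> vanish on the block and have seminorm at most \<open>2 * C\<close> before
  it, so only the weight of the past enters. The bound on \<open>v\<close> itself comes from
  \<open>x n = v\<close>.\<close>

lemma seminorm_cesaro_pow_block:
  assumes p: "seminorm p"
    and const: "\<And>i. N \<le> i \<Longrightarrow> i \<le> n \<Longrightarrow> x i = v"
    and bound: "\<And>i. i \<le> n \<Longrightarrow> p (x i) \<le> C"
    and "N \<le> n"
  shows "p ((cesaro ^^ k) x n - v) \<le> 2 * C * (cesaro ^^ k) (\<lambda>i. of_bool (i < N)) n"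
proof -
  have "p v \<le> C"
    using const[of n] bound[of n] \<open>N \<le> n\<close> by simp
  have "p ((cesaro ^^ k) x n - v) = p ((cesaro ^^ k) (\<lambda>i. x i - v) n)"
    by (simp add: cesaro_pow_diff_const)
  also have "\<dots> \<le> (cesaro ^^ k) (\<lambda>i. p (x i - v)) n"
    by (rule seminorm_cesaro_pow_le[OF p])
  also have "\<dots> \<le> (cesaro ^^ k) (\<lambda>i. 2 * C * of_bool (i < N)) n"
  proof (rule cesaro_pow_mono)
    fix i
    assume "i \<le> n"
    then show "p (x i - v) \<le> 2 * C * of_bool (i < N)"
      using seminorm_diff_le[OF p, of "x i" v] bound[of i] \<open>p v \<le> C\<close> const[of i]
      by (cases "i < N") (auto simp: seminorm_zero[OF p])
  qed
  also have "\<dots> = 2 * C * (cesaro ^^ k) (\<lambda>i. of_bool (i < N)) n"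
    by (simp add: cesaro_pow_mult)
  finally show ?thesis .
qed

lemma seminorm_nhd_subset:
  assumes top: "topology_given_by P" and sn: "\<And>p. p \<in> P \<Longrightarrow> seminorm p"
    and "open U" "x \<in> U"
  obtains F e where "finite F" "F \<subseteq> P" "e > 0" "{y. \<forall>p\<in>F. p (y - x) < e} \<subseteq> U"
proof -
  have "generate_topology {{y. p (y - x) < e} | p x e. p \<in> P \<and> e > 0} U"
    using top \<open>open U\<close> unfolding topology_given_by_def by simp
  then have "\<exists>F e. finite F \<and> F \<subseteq> P \<and> e > 0 \<and> {y. \<forall>p\<in>F. p (y - x) < e} \<subseteq> U"
    using \<open>x \<in> U\<close>
  proof (induction U rule: generate_topology.induct)
    case UNIV
    then show ?case
      by (intro exI[of _ "{}"] exI[of _ 1]) auto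
  next
    case (Int a b)
    have "x \<in> a" "x \<in> b"
      using Int.prems by simp_all
    obtain F e where F: "finite F" "F \<subseteq> P" "e > 0" "{y. \<forall>p\<in>F. p (y - x) < e} \<subseteq> a"
      using Int.IH(1)[OF \<open>x \<in> a\<close>] by (elim exE conjE) (rule that)
    obtain G d where G: "finite G" "G \<subseteq> P" "d > 0" "{y. \<forall>p\<in>G. p (y - x) < d} \<subseteq> b"
      using Int.IH(2)[OF \<open>x \<in> b\<close>] by (elim exE conjE) (rule that)
    have "{y. \<forall>p\<in>F \<union> G. p (y - x) < min e d}
        \<subseteq> {y. \<forall>p\<in>F. p (y - x) < e} \<inter> {y. \<forall>p\<in>G. p (y - x) < d}"
      by auto
    also have "\<dots> \<subseteq> a \<inter> b"
      using F(4) G(4) by (rule Int_mono)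
    finally show ?case
      using F G by (intro exI[of _ "F \<union> G"] exI[of _ "min e d"]) simp
  next
    case (UN K)
    then obtain k where "k \<in> K" "x \<in> k"
      by blast
    then obtain F e where "finite F" "F \<subseteq> P" "e > 0" "{y. \<forall>p\<in>F. p (y - x) < e} \<subseteq> k"
      using UN.IH[OF \<open>k \<in> K\<close> \<open>x \<in> k\<close>] by (elim exE conjE) (rule that)
    then show ?case
      using \<open>k \<in> K\<close> by (intro exI[of _ F] exI[of _ e]) auto
  next
    case (Basis s)
    from Basis(1) obtain p z e where s: "s = {y. p (y - z) < e}" "p \<in> P" "e > 0"
      by blast
    \<comment> \<open>Subbasic balls may have any centre \<open>z\<close>; the triangle inequality
      recentres them at \<open>x\<close>, at the cost of \<open>p (x - z)\<close> in the
      radius.\<close>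
    have "{y. \<forall>q\<in>{p}. q (y - x) < e - p (x - z)} \<subseteq> s"
    proof
      fix y
      assume "y \<in> {y. \<forall>q\<in>{p}. q (y - x) < e - p (x - z)}"
      then have "p (y - z) < e"
        using seminorm_triangle_diff[OF sn[OF \<open>p \<in> P\<close>], of y z x] by simp
      then show "y \<in> s"
        by (simp add: s(1))
    qed
    then show ?case
      using Basis(2) \<open>p \<in> P\<close> by (intro exI[of _ "{p}"] exI[of _ "e - p (x - z)"]) (simp add: s(1))
  qed
  then show thesis
    by (elim exE conjE) (rule that)
qed

lemma open_seminorm_ball:
  assumes "topology_given_by P" "p \<in> P" "e > 0"
  shows "open {y. p (y - x) < e}"
proof -
  have "generate_topology {{y. p (y - x) < e} | p x e. p \<in> P \<and> e > 0} {y. p (y - x) < e}"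
    using assms(2,3) by (intro generate_topology.Basis) blast
  then show ?thesis
    using assms(1) unfolding topology_given_by_def by simp
qed

lemma in_closure_seminormI:
  assumes top: "topology_given_by P" and sn: "\<And>p. p \<in> P \<Longrightarrow> seminorm p"
    and approx: "\<And>F e. finite F \<Longrightarrow> F \<subseteq> P \<Longrightarrow> e > 0 \<Longrightarrow> \<exists>y\<in>S. \<forall>p\<in>F. p (y - x) < e"
  shows "x \<in> closure S"
proof (rule ccontr)
  assume "x \<notin> closure S"
  then obtain F e where F: "finite F" "F \<subseteq> P" "e > 0" "{y. \<forall>p\<in>F. p (y - x) < e} \<subseteq> - closure S"
    using seminorm_nhd_subset[OF top sn, of "- closure S" x] by (auto simp: open_Compl)
  obtain y where "y \<in> S" "\<forall>p\<in>F. p (y - x) < e"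
    using approx F by blast
  then show False
    using F closure_subset[of S] by blast
qed

lemma in_closure_seminormD:
  assumes top: "topology_given_by P" and sn: "\<And>p. p \<in> P \<Longrightarrow> seminorm p"
    and x: "x \<in> closure S" and F: "finite F" "F \<subseteq> P" and "e > 0"
  shows "\<exists>y\<in>S. \<forall>p\<in>F. p (y - x) < e"
proof -
  define U where "U = (\<Inter>p\<in>F. {y. p (y - x) < e})"
  have "open U"
    unfolding U_def using F \<open>e > 0\<close> by (intro open_INT ballI open_seminorm_ball[OF top]) auto
  moreover have "x \<in> U"
    using F sn \<open>e > 0\<close> by (auto simp: U_def seminorm_zero)
  ultimately have "U \<inter> S \<noteq> {}"
    using x open_Int_closure_eq_empty[of U S] by blast
  then show ?thesis
    by (auto simp: U_def)
qed

text \<open>Separability passes to \<open>A\<close> because countably many seminorms yield countably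
  many test neighbourhoods: centre in \<open>C\<close>, finite subset of \<open>P\<close>, radius
  \<open>1 / real (Suc n)\<close>. One point of \<open>A\<close> is chosen in each of them that
  meets \<open>A\<close>.\<close>

lemma countable_dense_subset_seminorms:
  fixes P :: "('a::{real_vector,topological_space} \<Rightarrow> real) set" and A :: "'a set"
  assumes "countable P" and top: "topology_given_by P" and sn: "\<And>p. p \<in> P \<Longrightarrow> seminorm p"
    and sep: "separable_space (euclidean :: 'a topology)"
  obtains D where "countable D" "D \<subseteq> A" "A \<subseteq> closure D"
proof -
  obtain C :: "'a set" where C: "countable C" "closure C = UNIV"
    using sep by (auto simp: separable_space_def)
  define J where "J = C \<times> {F. finite F \<and> F \<subseteq> P} \<times> (UNIV :: nat set)"
  define near where "near = (\<lambda>(c, F, n) a. a \<in> A \<and> (\<forall>p\<in>F. p (a - c) < 1 / real (Suc n)))"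
  define D where "D = (\<lambda>t. SOME a. near t a) ` {t \<in> J. \<exists>a. near t a}"
  have near: "near t (SOME a. near t a)" if "\<exists>a. near t a" for t
    using that by (rule someI_ex)
  show thesis
  proof
    have "countable {F. finite F \<and> F \<subseteq> P}"
      by (rule countable_Collect_finite_subset) fact
    then show "countable D"
      using C by (auto simp: D_def J_def intro!: countable_image countable_subset[of _ J])
    show "D \<subseteq> A"
      using near by (fastforce simp: D_def near_def)
    show "A \<subseteq> closure D"
    proof
      fix a
      assume "a \<in> A"
      show "a \<in> closure D"
      proof (rule in_closure_seminormI[OF top sn])
        fix F and e :: real
        assume F: "finite F" "F \<subseteq> P" and "e > 0"
        obtain n where n: "1 / real (Suc n) < e / 2"
          using reals_Archimedean[of "e / 2"] \<open>e > 0\<close> by (auto simp: inverse_eq_divide)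
        obtain c where c: "c \<in> C" "\<forall>p\<in>F. p (c - a) < 1 / real (Suc n)"
          using in_closure_seminormD[OF top sn, of a C F "1 / real (Suc n)"] C F by auto
        have "p (a - c) < 1 / real (Suc n)" if "p \<in> F" for p
          using that c F seminorm_minus_commute[OF sn, of p a c] by auto
        then have "near (c, F, n) a"
          using \<open>a \<in> A\<close> by (simp add: near_def)
        then obtain b where b: "b \<in> D" "near (c, F, n) b"
          using near[of "(c, F, n)"] c F unfolding D_def J_def by blast
        \<comment> \<open>Both \<open>a\<close> and the chosen point \<open>b\<close> are within
          \<open>1 / real (Suc n) < e / 2\<close> of the same centre \<open>c\<close>.\<close>
        show "\<exists>y\<in>D. \<forall>p\<in>F. p (y - a) < e"
        proof (intro bexI ballI)
          fix p
          assume "p \<in> F"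
          then have "p (b - a) \<le> p (b - c) + p (c - a)"
            using F sn by (intro seminorm_triangle_diff) auto
          then show "p (b - a) < e"
            using b c \<open>p \<in> F\<close> n unfolding near_def by fastforce
        qed (use b in blast)
      qed auto
    qed
  qed
qed

subsection \<open>Sequences that are constant on rapidly growing blocks\<close>

text \<open>Once \<open>N m\<close> is fixed, the weight of the terms before it tends to zero for
  each of the finitely many orders \<open>k \<le> m\<close>, so a late enough end of the block beats
  the given factor \<open>S m\<close>. The last index of block \<open>m\<close> is
  \<open>N (Suc m) - 1\<close>.\<close>

lemma rapidly_growing_blocks:
  fixes S :: "nat \<Rightarrow> real"
  obtains N :: "nat \<Rightarrow> nat" where "strict_mono N"
    and "\<forall>m. \<forall>k\<le>m.
      (cesaro ^^ k) (\<lambda>i. of_bool (i < N m)) (N (Suc m) - 1) * S m < 1 / real (Suc m)"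
proof -
  let ?w = "\<lambda>k N n. (cesaro ^^ k) (\<lambda>i. of_bool (i < N) :: real) n"
  have "\<exists>N'>N. \<forall>k\<in>{..m}. ?w k N (N' - 1) * S m < 1 / real (Suc m)" for N m
  proof -
    have "\<forall>\<^sub>F n in sequentially. \<forall>k\<in>{..m}. ?w k N n * S m < 1 / real (Suc m)"
    proof (intro eventually_ball_finite ballI)
      fix k
      show "\<forall>\<^sub>F n in sequentially. ?w k N n * S m < 1 / real (Suc m)"
        using tendsto_mult_left_zero[OF cesaro_pow_initial_tendsto_zero[of k N], of "S m"]
        by (rule order_tendstoD) simp
    qed simp
    then obtain n where "n \<ge> N" "\<forall>k\<in>{..m}. ?w k N n * S m < 1 / real (Suc m)"
      unfolding eventually_sequentially by (metis nle_le)
    then show ?thesis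
      by (intro exI[of _ "Suc n"]) auto
  qed
  \<comment> \<open>The conjunct \<open>True\<close> fills the place of the invariant in
    \<open>dependent_nat_choice\<close>.\<close>
  then have "\<exists>N. \<forall>m. True \<and> (N m < N (Suc m) \<and>
      (\<forall>k\<in>{..m}. ?w k (N m) (N (Suc m) - 1) * S m < 1 / real (Suc m)))"
    by (intro dependent_nat_choice) auto
  then obtain N :: "nat \<Rightarrow> nat" where "\<forall>m. N m < N (Suc m)"
    "\<forall>m. \<forall>k\<in>{..m}. ?w k (N m) (N (Suc m) - 1) * S m < 1 / real (Suc m)"
    by blast
  then show thesis
    by (intro that[of N]) (auto simp: strict_mono_Suc_iff)
qed

text \<open>For strictly increasing \<open>N\<close> the indices below \<open>N 0\<close> are
  counted in block \<open>0\<close>.\<close>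

definition block :: "(nat \<Rightarrow> nat) \<Rightarrow> nat \<Rightarrow> nat" where
  "block N n = (LEAST m. n < N (Suc m))"

lemma block_le: "n < N (Suc m) \<Longrightarrow> block N n \<le> m"
  unfolding block_def by (rule Least_le)

lemma block_eq:
  assumes "strict_mono N" "N m \<le> n" "n < N (Suc m)"
  shows "block N n = m"
  unfolding block_def
proof (rule Least_equality)
  fix m'
  assume "n < N (Suc m')"
  then have "N m < N (Suc m')"
    using assms(2) by simp
  then show "m \<le> m'"
    using assms(1) by (simp add: strict_mono_less)
qed fact

text \<open>Block \<open>m\<close> serves the index \<open>J m\<close> with the value
  \<open>d m\<close>, and \<open>t m\<close> is its last index. The blocks are fixed once, before
  any combination, seminorm or tolerance is given; these only influence from which \<open>m\<close>
  on the estimate holds.\<close>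

lemma block_sequences:
  fixes P :: "('a::real_vector \<Rightarrow> real) set" and d :: "nat \<Rightarrow> 'a"
    and J :: "nat \<Rightarrow> nat" and L :: "nat \<Rightarrow> 'a list"
  assumes "countable P" and sn: "\<And>q. q \<in> P \<Longrightarrow> seminorm q"
  obtains u :: "nat \<Rightarrow> nat \<Rightarrow> 'a" and t :: "nat \<Rightarrow> nat"
  where "\<forall>j. \<forall>n<length (L j). u j n = L j ! n"
    and "\<forall>j n. u j n \<in> insert 0 (set (L j) \<union> range d)"
    and "\<forall>F c. finite F \<longrightarrow> (\<forall>j0\<in>F. \<forall>q\<in>P. \<forall>e>0.
      \<forall>\<^sub>F m in sequentially. \<forall>k\<le>m. J m = j0 \<longrightarrow>
        q ((cesaro ^^ k) (\<lambda>n. \<Sum>j\<in>F. c j *\<^sub>R u j n) (t m) - c j0 *\<^sub>R d m) < e)"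
proof -
  \<comment> \<open>Adjoining \<open>0\<close> only serves to make the enumerated set nonempty.\<close>
  define p where "p = from_nat_into (insert (\<lambda>_. 0) P)"
  have range_p: "range p = insert (\<lambda>_. 0) P"
    unfolding p_def using \<open>countable P\<close> by (intro range_from_nat_into) auto
  have sn_p: "seminorm (p i)" for i
    using range_p sn by (metis insertE rangeI seminorm_def abs_0 add_0 mult_zero_right order_refl)
  \<comment> \<open>A diagonal bound: each fixed seminorm \<open>p i\<close> of the values used up
    to block \<open>m\<close> is dominated by \<open>S m\<close> as soon as
    \<open>m \<ge> i\<close>. The summand \<open>1\<close> gives \<open>1 \<le> S m\<close>, so that
    the initial lists can be absorbed as well.\<close>
  define S where "S m = 1 + (\<Sum>i\<le>m. \<Sum>m'\<le>m. p i (d m'))" for m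
  obtain N where N: "strict_mono N"
    and small: "\<forall>m. \<forall>k\<le>m.
      (cesaro ^^ k) (\<lambda>i. of_bool (i < N m)) (N (Suc m) - 1) * S m < 1 / real (Suc m)"
    using rapidly_growing_blocks[of S] .
  define u where "u j n = (if n < length (L j) then L j ! n
    else if J (block N n) = j then d (block N n) else 0)" for j n
  show thesis
  proof (rule that[of u "\<lambda>m. N (Suc m) - 1"]; (intro allI ballI impI)?)
    show "u j n = L j ! n" if "n < length (L j)" for j n
      using that by (simp add: u_def)
    show "u j n \<in> insert 0 (set (L j) \<union> range d)" for j n
      by (simp add: u_def)
  next
    fix F :: "nat set" and c :: "nat \<Rightarrow> real" and j0 q and e :: real
    assume F: "finite F" "j0 \<in> F" and "q \<in> P" and "e > 0"
    have q: "seminorm q"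
      using sn \<open>q \<in> P\<close> .
    obtain i where i: "q = p i"
      using range_p \<open>q \<in> P\<close> by (metis imageE insertCI)
    define x where "x n = (\<Sum>j\<in>F. c j *\<^sub>R u j n)" for n
    define B where "B j = (\<Sum>v\<in>set (L j). q v)" for j
    \<comment> \<open>\<open>C * S m\<close> bounds \<open>q\<close> on the combination up to the
      end of block \<open>m\<close>: \<open>B j\<close> accounts for the initial list of
      \<open>u j\<close>, the \<open>1\<close> for its block values.\<close>
    define C where "C = (\<Sum>j\<in>F. \<bar>c j\<bar> * (1 + B j))"
    have B_nonneg: "0 \<le> B j" for j
      unfolding B_def by (intro sum_nonneg seminorm_nonneg[OF q])
    have C_nonneg: "0 \<le> C"
      unfolding C_def using B_nonneg by (intro sum_nonneg mult_nonneg_nonneg add_nonneg_nonneg) auto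
    have S_ge: "1 \<le> S m" for m
      unfolding S_def by (simp add: sum_nonneg seminorm_nonneg[OF sn_p])
    have q_d: "q (d m') \<le> S m" if "i \<le> m" "m' \<le> m" for m m'
    proof -
      have "q (d m') \<le> (\<Sum>m'\<le>m. q (d m'))"
        using that by (intro member_le_sum) (auto simp: seminorm_nonneg[OF q])
      also have "\<dots> \<le> (\<Sum>i\<le>m. \<Sum>m'\<le>m. p i (d m'))"
        unfolding i using that
        by (intro member_le_sum[of i "{..m}" "\<lambda>i. \<Sum>m'\<le>m. p i (d m')"])
          (auto intro: sum_nonneg simp: seminorm_nonneg[OF sn_p])
      finally show ?thesis
        by (simp add: S_def)
    qed
    have q_u: "q (u j n) \<le> (1 + B j) * S m" if "i \<le> m" "n < N (Suc m)" for j n m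
    proof -
      have le: "S m \<le> (1 + B j) * S m"
        using B_nonneg[of j] S_ge[of m] mult_right_mono[of 1 "1 + B j" "S m"] by simp
      have "B j * 1 \<le> (1 + B j) * S m"
        using B_nonneg[of j] S_ge[of m] by (intro mult_mono) auto
      moreover have "q (L j ! n) \<le> B j" if "n < length (L j)"
        unfolding B_def using that by (intro member_le_sum) (auto simp: seminorm_nonneg[OF q])
      moreover have "q (d (block N n)) \<le> (1 + B j) * S m"
        using order_trans[OF q_d[OF that(1) block_le[of n N m]] le] that(2) by simp
      ultimately show ?thesis
        using B_nonneg[of j] S_ge[of m] by (auto simp: u_def seminorm_zero[OF q])
    qed
    have q_x: "q (x n) \<le> C * S m" if "i \<le> m" "n < N (Suc m)" for n m
    proof -
      have "q (x n) \<le> (\<Sum>j\<in>F. q (c j *\<^sub>R u j n))"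
        unfolding x_def by (rule seminorm_sum[OF q])
      also have "\<dots> \<le> (\<Sum>j\<in>F. \<bar>c j\<bar> * ((1 + B j) * S m))"
        using q_u[OF that] by (intro sum_mono) (simp add: seminorm_scaleR[OF q] mult_left_mono)
      also have "\<dots> = C * S m"
        by (simp add: C_def sum_distrib_right mult.assoc)
      finally show ?thesis .
    qed
    \<comment> \<open>Three requirements on \<open>m\<close>: the initial lists have ended,
      \<open>2 * C / real (Suc m)\<close> is below \<open>e\<close>, and \<open>S m\<close> already
      controls \<open>q = p i\<close>.\<close>
    have "\<forall>\<^sub>F m in sequentially. \<forall>j\<in>F. length (L j) \<le> m"
      using F by (intro eventually_ball_finite ballI eventually_ge_at_top)
    moreover have "\<forall>\<^sub>F m in sequentially. 2 * C / e < real m"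
      by (rule eventually_compose_filterlim[OF eventually_gt_at_top filterlim_real_sequentially])
    ultimately have "\<forall>\<^sub>F m in sequentially. \<forall>k\<le>m. J m = j0 \<longrightarrow>
        q ((cesaro ^^ k) x (N (Suc m) - 1) - c j0 *\<^sub>R d m) < e"
      using eventually_ge_at_top[of i]
    proof eventually_elim
      case (elim m)
      show ?case
      proof (intro allI impI)
        fix k
        assume "k \<le> m" and "J m = j0"
        let ?n = "N (Suc m) - 1"
        let ?w = "(cesaro ^^ k) (\<lambda>i. of_bool (i < N m)) ?n :: real"
        have "N m < N (Suc m)"
          using N by (simp add: strict_mono_less)
        have "x n = c j0 *\<^sub>R d m" if "N m \<le> n" "n \<le> ?n" for n
        proof -
          have "block N n = m"
            using that \<open>N m < N (Suc m)\<close> by (intro block_eq[OF N]) auto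
          \<comment> \<open>Strict monotonicity gives \<open>m \<le> N m\<close>, so the whole block
            lies beyond the initial lists.\<close>
          moreover have "length (L j) \<le> n" if "j \<in> F" for j
            using elim(1) that \<open>N m \<le> n\<close> strict_mono_imp_increasing[OF N, of m] by fastforce
          ultimately have "u j n = (if j = j0 then d m else 0)" if "j \<in> F" for j
            using that \<open>J m = j0\<close> by (simp add: u_def leD)
          then have "x n = (\<Sum>j\<in>F. if j = j0 then c j *\<^sub>R d m else 0)"
            unfolding x_def by (intro sum.cong) auto
          then show ?thesis
            using F by simp
        qed
        then have "q ((cesaro ^^ k) x ?n - c j0 *\<^sub>R d m) \<le> 2 * (C * S m) * ?w"
          using q_x[OF elim(3)] \<open>N m < N (Suc m)\<close>
          by (intro seminorm_cesaro_pow_block[OF q]) auto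
        also have "\<dots> = 2 * C * (?w * S m)"
          by simp
        \<comment> \<open>The growing factor \<open>S m\<close> was built into the choice of
          \<open>N\<close>; only the constant \<open>C\<close> of the combination remains.\<close>
        also have "\<dots> \<le> 2 * C * (1 / real (Suc m))"
          using C_nonneg small[rule_format, OF \<open>k \<le> m\<close>] by (intro mult_left_mono) auto
        also have "\<dots> < e"
        proof -
          have "2 * C < e * real m"
            using elim(2) \<open>e > 0\<close> by (simp add: field_simps)
          also have "\<dots> \<le> e * real (Suc m)"
            using \<open>e > 0\<close> by simp
          finally show ?thesis
            by (simp add: divide_less_eq)
        qed
        finally show "q ((cesaro ^^ k) x ?n - c j0 *\<^sub>R d m) < e" .
      qed
    qed
    then show "\<forall>\<^sub>F m in sequentially. \<forall>k\<le>m. J m = j0 \<longrightarrow>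
        q ((cesaro ^^ k) (\<lambda>n. \<Sum>j\<in>F. c j *\<^sub>R u j n) (N (Suc m) - 1) - c j0 *\<^sub>R d m) < e"
      unfolding x_def .
  qed
qed

subsection \<open>Spaces of sequences\<close>

lemma subspace_seqs: "subspace A \<Longrightarrow> subspace (seqs A)"
  by (auto simp: subspace_def seqs_def scaleR_fun_def)

lemma sum_fun_apply: "(\<Sum>i\<in>F. f i) n = (\<Sum>i\<in>F. f i n)"
  by (induction F rule: infinite_finite_induct) auto

lemma span_range_nonzeroE:
  fixes u :: "'i \<Rightarrow> 'a::real_vector"
  assumes "x \<in> span (range u)" "x \<noteq> 0"
  obtains F c j where "finite F" "x = (\<Sum>j\<in>F. c j *\<^sub>R u j)" "j \<in> F" "c j \<noteq> 0"
proof -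
  obtain V r where V: "finite V" "V \<subseteq> range u" "x = (\<Sum>v\<in>V. r v *\<^sub>R v)"
    using assms(1) unfolding span_explicit by blast
  \<comment> \<open>The family \<open>u\<close> may repeat vectors; one index per vector turns a
    combination over vectors into one over indices.\<close>
  obtain F where F: "inj_on u F" "V = u ` F"
    using V(2) unfolding subset_image_inj by blast
  have "x = (\<Sum>j\<in>F. r (u j) *\<^sub>R u j)"
    using F V by (simp add: sum.reindex)
  moreover have "finite F"
    using F V by (simp add: finite_image_iff)
  moreover have "\<exists>j\<in>F. r (u j) \<noteq> 0"
  proof (rule ccontr)
    assume "\<not> (\<exists>j\<in>F. r (u j) \<noteq> 0)"
    then have "(\<Sum>j\<in>F. r (u j) *\<^sub>R u j) = 0"
      by (intro sum.neutral) simp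
    then show False
      using calculation(1) \<open>x \<noteq> 0\<close> by simp
  qed
  ultimately show thesis
    using that[of F "\<lambda>j. r (u j)"] by blast
qed

text \<open>A basic open set of the product topology restricts finitely many coordinates, all below
  some \<open>n\<close>. A list over \<open>D\<close> of length \<open>n\<close> with entries in the
  prescribed open sets then suffices, whatever follows it.\<close>

lemma seqs_subset_closureI:
  fixes A :: "'a::topological_space set"
  assumes "A \<subseteq> closure D"
    and prefix: "\<And>l. l \<in> lists D \<Longrightarrow> \<exists>s\<in>E. \<forall>n<length l. s n = l ! n"
  shows "seqs A \<subseteq> closure E"
proof
  fix x
  assume x: "x \<in> seqs A"
  have "U \<inter> E \<noteq> {}" if U: "open U" "x \<in> U" for U
  proof -
    obtain X where X: "x \<in> (\<Pi>\<^sub>E i\<in>UNIV. X i)" "\<And>i. open (X i)" "finite {i. X i \<noteq> UNIV}"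
      "(\<Pi>\<^sub>E i\<in>UNIV. X i) \<subseteq> U"
      using product_topology_open_contains_basis[of "\<lambda>_. euclidean" UNIV U x] U
      by (auto simp: open_fun_def)
    obtain n where n: "\<And>i. X i \<noteq> UNIV \<Longrightarrow> i < n"
      using X(3) by (metis (mono_tags, lifting) finite_nat_set_iff_bounded mem_Collect_eq)
    have "\<exists>y. y \<in> D \<and> y \<in> X i" for i
    proof -
      have "x i \<in> X i \<inter> closure D"
        using X(1) x assms(1) by (auto simp: seqs_def PiE_iff)
      then show ?thesis
        using open_Int_closure_eq_empty[OF X(2), of i D] by blast
    qed
    then obtain g where g: "\<And>i. g i \<in> D" "\<And>i. g i \<in> X i"
      by metis
    obtain s where s: "s \<in> E" "\<forall>i<n. s i = g i"
      using prefix[of "map g [0..<n]"] g(1) by (auto simp: in_lists_conv_set)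
    have "s i \<in> X i" for i
      using s g n[of i] by (cases "i < n") auto
    then have "s \<in> (\<Pi>\<^sub>E i\<in>UNIV. X i)"
      by (simp add: PiE_iff)
    then show ?thesis
      using X(4) s by blast
  qed
  then show "x \<in> closure E"
    by (metis Compl_iff closed_closure closure_subset disjoint_iff open_Compl subsetD)
qed

lemma countable_set_recurrent_enumeration:
  assumes "countable D" "D \<noteq> {}"
  obtains d :: "nat \<Rightarrow> 'a" and J :: "nat \<Rightarrow> nat"
  where "range d \<subseteq> D" "\<forall>j M. \<forall>y\<in>D. \<exists>m\<ge>M. J m = j \<and> d m = y"
proof (rule that[of "\<lambda>m. from_nat_into D (snd (prod_decode (snd (prod_decode m))))"
      "\<lambda>m. fst (prod_decode (snd (prod_decode m)))"]; (intro allI ballI)?)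
  fix j y and M :: nat
  assume "y \<in> D"
  then obtain l where "y = from_nat_into D l"
    using assms(1) by (metis from_nat_into_to_nat_on)
  then show "\<exists>m\<ge>M. fst (prod_decode (snd (prod_decode m))) = j \<and>
      from_nat_into D (snd (prod_decode (snd (prod_decode m)))) = y"
    \<comment> \<open>The first component is ignored by \<open>J\<close> and \<open>d\<close>; it
      makes every pair recur and forces the code to be at least \<open>M\<close>.\<close>
    by (intro exI[of _ "prod_encode (M, prod_encode (j, l))"]) (simp add: le_prod_encode_1)
qed (use assms in \<open>auto intro: from_nat_into\<close>)

theorem mainTheorem3:
  fixes P :: "('a::{real_vector,topological_space} \<Rightarrow> real) set"
    and A :: "'a set"
  assumes "countable P"
    and "\<forall>p\<in>P. seminorm p"
    and "separating P"
    and "topology_given_by P"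
    and "separable_space (euclidean :: 'a topology)"
    and "subspace A"
  shows "\<exists>E :: (nat \<Rightarrow> 'a) set.
           subspace E \<and> dense_in E (seqs A) \<and> E - {0} \<subseteq> Theta A"
proof -
  have sn: "seminorm p" if "p \<in> P" for p
    using assms(2) that by blast
  note top = \<open>topology_given_by P\<close>
  obtain D where D: "countable D" "D \<subseteq> A" "A \<subseteq> closure D"
    using countable_dense_subset_seminorms[OF \<open>countable P\<close> top sn assms(5)] .
  have "D \<noteq> {}"
    using D(3) subspace_0[OF \<open>subspace A\<close>] by auto
  obtain d and J :: "nat \<Rightarrow> nat" where d: "range d \<subseteq> D" "\<forall>j M. \<forall>y\<in>D. \<exists>m\<ge>M. J m = j \<and> d m = y"
    using countable_set_recurrent_enumeration[OF D(1) \<open>D \<noteq> {}\<close>] .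
  define L where "L = from_nat_into (lists D)"
  have range_L: "range L = lists D"
    unfolding L_def using D(1) by (intro range_from_nat_into) auto
  obtain u t where u_init: "\<forall>j. \<forall>n<length (L j). u j n = L j ! n"
    and u_mem: "\<forall>j n. u j n \<in> insert 0 (set (L j) \<union> range d)"
    and u_approx: "\<forall>F c. finite F \<longrightarrow> (\<forall>j0\<in>F. \<forall>q\<in>P. \<forall>e>0.
      \<forall>\<^sub>F m in sequentially. \<forall>k\<le>m. J m = j0 \<longrightarrow>
        q ((cesaro ^^ k) (\<lambda>n. \<Sum>j\<in>F. c j *\<^sub>R u j n) (t m) - c j0 *\<^sub>R d m) < e)"
    using block_sequences[OF \<open>countable P\<close> sn, where L = L and d = d and J = J] .
  have "u j n \<in> A" for j n
  proof -
    have "L j \<in> lists D"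
      using range_L by blast
    then have "set (L j) \<subseteq> D"
      by (simp add: in_lists_conv_set subset_iff)
    then have "insert 0 (set (L j) \<union> range d) \<subseteq> A"
      using d(1) D(2) subspace_0[OF \<open>subspace A\<close>] by auto
    then show ?thesis
      using u_mem[rule_format, of j n] by (rule subsetD)
  qed
  then have span_subset: "span (range u) \<subseteq> seqs A"
    by (intro span_minimal subspace_seqs[OF \<open>subspace A\<close>]) (auto simp: seqs_def)
  have "\<exists>s\<in>span (range u). \<forall>n<length l. s n = l ! n" if "l \<in> lists D" for l
  proof -
    have "l \<in> range L"
      using that range_L by simp
    then obtain j where "l = L j"
      by (rule rangeE)
    then show ?thesis
      using u_init by (intro bexI[of _ "u j"] span_base) auto
  qed
  from seqs_subset_closureI[OF D(3) this] have "dense_in (span (range u)) (seqs A)"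
    using span_subset by (simp add: dense_in_def)
  moreover have "x \<in> Theta A" if "x \<in> span (range u)" "x \<noteq> 0" for x
  proof -
    obtain F c j where F: "finite F" "x = (\<Sum>j\<in>F. c j *\<^sub>R u j)" "j \<in> F" "c j \<noteq> 0"
      using span_range_nonzeroE[OF \<open>x \<in> span (range u)\<close> \<open>x \<noteq> 0\<close>] .
    have x_eq: "x = (\<lambda>n. \<Sum>j\<in>F. c j *\<^sub>R u j n)"
      using F(2) by (simp add: fun_eq_iff sum_fun_apply scaleR_fun_def)
    have "x \<in> seqs A"
      using that span_subset by blast
    have "a \<in> closure (range ((cesaro ^^ k) x))" if "a \<in> A" for a k
    proof (rule in_closure_seminormI[OF top sn])
      fix G and e :: real
      assume G: "finite G" "G \<subseteq> P" and "e > 0"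
      \<comment> \<open>At the blocks serving \<open>j\<close> the means are close to
        \<open>c j\<close> times a point of \<open>D\<close>. To reach \<open>a\<close>, that point
        must approximate \<open>a\<close> divided by \<open>c j\<close>, with a tolerance that
        becomes \<open>e / 2\<close> after multiplication by \<open>c j\<close>.\<close>
      have "a /\<^sub>R c j \<in> closure D"
        using D(3) \<open>a \<in> A\<close> \<open>subspace A\<close> by (auto intro: subspace_scale)
      then obtain y where y: "y \<in> D" "\<forall>p\<in>G. p (y - a /\<^sub>R c j) < e / (2 * \<bar>c j\<bar>)"
        using in_closure_seminormD[OF top sn _ G] \<open>e > 0\<close> \<open>c j \<noteq> 0\<close>
        by (metis divide_pos_pos mult_pos_pos zero_less_abs_iff zero_less_numeral)
      have "\<forall>\<^sub>F m in sequentially. \<forall>p\<in>G. \<forall>k\<le>m. J m = j \<longrightarrow>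
          p ((cesaro ^^ k) x (t m) - c j *\<^sub>R d m) < e / 2"
        unfolding x_eq using G F \<open>e > 0\<close>
        by (intro eventually_ball_finite ballI u_approx[rule_format]) auto
      then obtain M where M: "\<And>m. m \<ge> M \<Longrightarrow> \<forall>p\<in>G. \<forall>k\<le>m. J m = j \<longrightarrow>
          p ((cesaro ^^ k) x (t m) - c j *\<^sub>R d m) < e / 2"
        unfolding eventually_sequentially by blast
      \<comment> \<open>Recurrence supplies a late block with this \<open>j\<close> and
        \<open>y\<close>; \<open>m \<ge> k\<close> is required since block \<open>m\<close> controls
        only the orders up to \<open>m\<close>.\<close>
      obtain m where m: "m \<ge> max M k" "J m = j" "d m = y"
        using d(2) \<open>y \<in> D\<close> by blast
      have "p ((cesaro ^^ k) x (t m) - a) < e" if "p \<in> G" for p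
      proof -
        have p: "seminorm p"
          using that G sn by blast
        have "c j *\<^sub>R y - a = c j *\<^sub>R (y - a /\<^sub>R c j)"
          using \<open>c j \<noteq> 0\<close> by (simp add: scaleR_diff_right)
        then have "p (c j *\<^sub>R y - a) = \<bar>c j\<bar> * p (y - a /\<^sub>R c j)"
          by (simp add: seminorm_scaleR[OF p])
        also have "\<dots> < \<bar>c j\<bar> * (e / (2 * \<bar>c j\<bar>))"
          using y that \<open>c j \<noteq> 0\<close> by (intro mult_strict_left_mono) auto
        finally have "p (c j *\<^sub>R y - a) < e / 2"
          using \<open>c j \<noteq> 0\<close> by simp
        moreover have "p ((cesaro ^^ k) x (t m) - c j *\<^sub>R y) < e / 2"
          using M[of m] m that by auto
        ultimately show ?thesis
          using seminorm_triangle_diff[OF p, of "(cesaro ^^ k) x (t m)" a "c j *\<^sub>R y"] by simp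
      qed
      then show "\<exists>z\<in>range ((cesaro ^^ k) x). \<forall>p\<in>G. p (z - a) < e"
        by blast
    qed auto
    moreover have "range ((cesaro ^^ k) x) \<subseteq> A" for k
      using cesaro_pow_mem_subspace[OF \<open>subspace A\<close> \<open>x \<in> seqs A\<close>, of k] by (auto simp: seqs_def)
    moreover have "convex hull A = A"
      using subspace_imp_convex[OF \<open>subspace A\<close>] by (rule hull_same)
    ultimately show ?thesis
      using \<open>x \<in> seqs A\<close> by (auto simp: Theta_def dense_in_def)
  qed
  ultimately show ?thesis
    by (intro exI[of _ "span (range u)"]) auto
qed

end
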